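(* Let $n$ be a positive integer. Assume that $\boldsymbol{s}=(s_1,\ldots,s_n,0)$, $\boldsymbol{s}'=(s'_1,\ldots,s'_n,0)$ and $\boldsymbol{s}''=(s''_1,\ldots,s''_n,0)$ are sequences of nonnegative integers such that $$s_i\equiv s_i'\equiv s_{n+1-i}'' \pmod{q-1}\quad\text{for } i=1,2,\ldots,n,$$ $$s_i=s_i'=s_{n+1-i}''\quad\text{whenever } 1<i<n \text{ and } \min\{s_i,s_i',s_{n+1-i}''\}=0.$$ Let $a,b\in\{0,1\}$ be such that $a=b$ if and only if $n$ is odd. Let $\alpha=\mu_{a,n+1}(\boldsymbol{s})$, and let $\beta$ be either $\mu_{a,n+1}(\boldsymbol{s}')$ or $\mu_{b,n+1}(\boldsymbol{s}'')$. Suppose that $\alpha,\beta\in\Omega$ and that, if $\boldsymbol{s}\neq\boldsymbol{s}'$, then $\mu_{b,n-m}(\boldsymbol{s}'')\in\Omega\cup\{*\}$, where $m$ is the smallest integer such that $s_m\ne s_m'$. Then, for edges $([l],\langle r\rangle)$ of $\Gamma(\Omega,q)$, $$\zeta_{\mathrm L}(\alpha,[l])+\zeta_{\mathrm R}(\alpha,\langle r\rangle)\stackrel{n}{=}\zeta_{\mathrm L}(\beta,[l])+\zeta_{\mathrm R}(\beta,\langle r\rangle),$$ that is, there are a polynomial $f$ over $\mathbb{F}_q$ in the variables $\{l_\gamma:\gamma\in\Delta_n(\Omega)\}$ and a polynomial $g$ over $\mathbb{F}_q$ in the variables $\{r_\gamma:\gamma\in\Delta_n(\Omega)\}$ such that,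 for each edge $([l],\langle r\rangle)\in E(\Gamma(\Omega,q))$, $$\zeta_{\mathrm L}(\alpha,[l])+\zeta_{\mathrm R}(\alpha,\langle r\rangle)-\zeta_{\mathrm L}(\beta,[l])-\zeta_{\mathrm R}(\beta,\langle r\rangle)=f+g.$$
   Context: Let $q$ be a prime power and $\mathbb{F}_q$ the field with $q$ elements; $x^0=1$ for every $x\in\mathbb{F}_q$. $\{0,1\}^*$ is the set of finite binary sequences, $\eta$ the null sequence; juxtaposition is concatenation; $\alpha^i$ is the $i$-fold concatenation of $\alpha$ ($\alpha^0=\eta$). $\Omega\subset\{0,1\}^*$ is a finite set satisfying condition C1: $\eta\in\Omega$, and for any $\alpha\in\Omega\setminus\{\eta\}$ the sequence obtained by deleting the last bit of $\alpha$ is in $\Omega$. $L(\Omega)$ and $R(\Omega)$ are two disjoint copies of $\mathbb{F}_q^{|\Omega|+1}$; their vectors are written $[l]$ and $\langle r\rangle$ respectively, with entries indexed by $\Omega\cup\{*\}$, where $*\notin\Omega$ is an extra symbol. $\Gamma(\Omega,q)$ is the bipartite graph with vertex set $L(\Omega)\cup R(\Omega)$ in which $[l]\in L(\Omega)$ and $\langle r\rangle\in R(\Omega)$ are adjacent if and only if $l_\eta+r_\eta=l_*r_*$, $l_{\alpha0}+r_{\alpha0}=r_*l_\alpha$ for all $\alpha0\in\Omega$, and $l_{\beta1}+r_{\beta1}=l_*r_\beta$ for all $\beta1\in\Omega$ (here $\alpha,\beta\in\{0,1\}^*$). By convention $*0=*1=\eta$ (so e.g. $*10^t=0^t$ and $*01^t=1^t$).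 For $a\in\{0,1\}$ (also treated as an integer) and a sequence $\boldsymbol{s}=(s_1,s_2,\ldots)$ of nonnegative integers, put $\mu_{a,0}(\boldsymbol{s})=*$ and, for $i\ge1$, $\mu_{a,i}(\boldsymbol{s})=\mu_{a,i-1}(\boldsymbol{s})10^{s_i}$ if $i+a$ is odd and $\mu_{a,i}(\boldsymbol{s})=\mu_{a,i-1}(\boldsymbol{s})01^{s_i}$ if $i+a$ is even. Every nonempty $\alpha\in\{0,1\}^*$ can be written uniquely as $\alpha=\mu_{a,n+1}(s_1,\ldots,s_n,0)=\mu_{a,n}(s_1,\ldots,s_{n-1},s_n+1)$ with $a\in\{0,1\}$, $n\ge1$ and nonnegative integers $s_1,\dots,s_n$. For such $\alpha$ define $\kappa(\alpha)=n$ and, when $\alpha\in\Omega$, $$\zeta_{\mathrm L}(\alpha,[l])=\begin{cases}\sum_{t=0}^{s_n+1}l_*^{s_n+1-t}\,l_{\mu_{a,n-1}(s_1,\ldots,s_{n-1})01^t}& n+a\text{ even},\\ l_\alpha& n+a\text{ odd},\end{cases}$$ $$\zeta_{\mathrm R}(\alpha,\langle r\rangle)=\begin{cases}\sum_{t=0}^{s_n+1}r_*^{s_n+1-t}\,r_{\mu_{a,n-1}(s_1,\ldots,s_{n-1})10^t}& n+a\text{ odd},\\ r_\alpha& n+a\text{ even}.\end{cases}$$ For a positive integer $n$, $\Delta_n(\Omega)=\{\beta\in\Omega\setminus\{\eta\}:\kappa(\beta)<n\}\cup\{*,\eta\}$. *)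

theory Defs
  imports
    "HOL-Library.Cardinality"
    "HOL-Library.FuncSet"
    "HOL-Library.Poly_Mapping"
    "HOL-Number_Theory.Cong"
begin

text \<open>The bits 0 and 1 are \<open>False\<close> and \<open>True\<close>. \<open>Star\<close> is the extra symbol \<open>*\<close>.\<close>

datatype index = Star | Seq "bool list"

text \<open>Concatenation on the right, with the convention \<open>*0 = *1 = \<eta>\<close>.\<close>

fun append_bits :: "index \<Rightarrow> bool list \<Rightarrow> index" (infixl "\<frown>" 65) where
  "Star \<frown> [] = Star"
| "Star \<frown> (x # xs) = Seq xs"
| "Seq ys \<frown> xs = Seq (ys @ xs)"

definition C1 :: "bool list set \<Rightarrow> bool" where
  "C1 \<Omega> \<longleftrightarrow> [] \<in> \<Omega> \<and> (\<forall>\<alpha>\<in>\<Omega> - {[]}. butlast \<alpha> \<in> \<Omega>)"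

definition indices :: "bool list set \<Rightarrow> index set" where
  "indices \<Omega> = insert Star (Seq ` \<Omega>)"

definition vectors :: "bool list set \<Rightarrow> (index \<Rightarrow> 'a) set" where
  "vectors \<Omega> = indices \<Omega> \<rightarrow>\<^sub>E UNIV"

text \<open>The tags keep the two copies of the vector space disjoint.\<close>

datatype 'a vertex = LV "index \<Rightarrow> 'a" | RV "index \<Rightarrow> 'a"

definition adjacent :: "bool list set \<Rightarrow> (index \<Rightarrow> 'a::field) \<Rightarrow> (index \<Rightarrow> 'a) \<Rightarrow> bool" where
  "adjacent \<Omega> l r \<longleftrightarrow>
     l (Seq []) + r (Seq []) = l Star * r Star \<and>
     (\<forall>\<alpha>. \<alpha> @ [False] \<in> \<Omega> \<longrightarrow>
        l (Seq (\<alpha> @ [False])) + r (Seq (\<alpha> @ [False])) = r Star * l (Seq \<alpha>)) \<and>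
     (\<forall>\<beta>. \<beta> @ [True] \<in> \<Omega> \<longrightarrow>
        l (Seq (\<beta> @ [True])) + r (Seq (\<beta> @ [True])) = l Star * r (Seq \<beta>))"

text \<open>Every edge of the bipartite graph is listed once, with its left end first.\<close>

definition edges :: "bool list set \<Rightarrow> ('a::field vertex \<times> 'a vertex) set" where
  "edges \<Omega> = {(LV l, RV r) | l r. l \<in> vectors \<Omega> \<and> r \<in> vectors \<Omega> \<and> adjacent \<Omega> l r}"

text \<open>
  Sequences of nonnegative integers are functions whose entries are numbered from 1; the
  entry at 0 is never used, and \<open>mu a i s\<close> depends on the entries \<open>s 1, \<dots>, s i\<close> only.
\<close>

primrec mu :: "nat \<Rightarrow> nat \<Rightarrow> (nat \<Rightarrow> nat) \<Rightarrow> index" where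
  "mu a 0 s = Star"
| "mu a (Suc i) s = mu a i s \<frown>
     (if odd (Suc i + a) then True # replicate (s (Suc i)) False
      else False # replicate (s (Suc i)) True)"

text \<open>
  \<open>decomposition \<alpha> a n s\<close> expresses that \<open>\<alpha> = \<mu>\<^bsub>a,n+1\<^esub>(s\<^sub>1, \<dots>, s\<^sub>n, 0)\<close>. For nonempty \<open>\<alpha>\<close> it
  determines \<open>a\<close>, \<open>n\<close> and \<open>s 1, \<dots>, s n\<close>, so the descriptions below are unique.
\<close>

definition decomposition :: "bool list \<Rightarrow> nat \<Rightarrow> nat \<Rightarrow> (nat \<Rightarrow> nat) \<Rightarrow> bool" where
  "decomposition \<alpha> a n s \<longleftrightarrow>
     a \<in> {0, 1} \<and> n \<ge> 1 \<and> s (n + 1) = 0 \<and> Seq \<alpha> = mu a (n + 1) s"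

definition kappa :: "bool list \<Rightarrow> nat" where
  "kappa \<alpha> = (THE n. \<exists>a s. decomposition \<alpha> a n s)"

definition zeta_L :: "bool list \<Rightarrow> (index \<Rightarrow> 'a::field) \<Rightarrow> 'a" where
  "zeta_L \<alpha> l = (THE v. \<exists>a n s. decomposition \<alpha> a n s \<and>
     v = (if even (n + a)
          then \<Sum>t = 0..s n + 1. l Star ^ (s n + 1 - t) *
                 l (mu a (n - 1) s \<frown> (False # replicate t True))
          else l (Seq \<alpha>)))"

definition zeta_R :: "bool list \<Rightarrow> (index \<Rightarrow> 'a::field) \<Rightarrow> 'a" where
  "zeta_R \<alpha> r = (THE v. \<exists>a n s. decomposition \<alpha> a n s \<and>
     v = (if odd (n + a)
          then \<Sum>t = 0..s n + 1. r Star ^ (s n + 1 - t) *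
                 r (mu a (n - 1) s \<frown> (True # replicate t False))
          else r (Seq \<alpha>)))"

definition Delta :: "nat \<Rightarrow> bool list set \<Rightarrow> index set" where
  "Delta n \<Omega> = Seq ` {\<beta> \<in> \<Omega> - {[]}. kappa \<beta> < n} \<union> {Star, Seq []}"

text \<open>
  Multivariate polynomials are finitely supported maps from monomials to coefficients, a
  monomial being a finitely supported map from variables to exponents.
\<close>

type_synonym ('v, 'a) mpoly = "('v \<Rightarrow>\<^sub>0 nat) \<Rightarrow>\<^sub>0 'a"

definition mpoly_vars :: "('v, 'a::zero) mpoly \<Rightarrow> 'v set" where
  "mpoly_vars p = (\<Union>m\<in>Poly_Mapping.keys p. Poly_Mapping.keys m)"

definition mpoly_eval :: "('v, 'a::comm_semiring_1) mpoly \<Rightarrow> ('v \<Rightarrow> 'a) \<Rightarrow> 'a" where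
  "mpoly_eval p x = (\<Sum>m\<in>Poly_Mapping.keys p.
     Poly_Mapping.lookup p m * (\<Prod>v\<in>Poly_Mapping.keys m. x v ^ Poly_Mapping.lookup m v))"

end

theory Submission
  imports Defs
begin

text \<open>
  Write \<open>w\<^sub>0 = l\<close> and \<open>w\<^sub>1 = r\<close> for the two ends of an edge and \<open>c'\<close> for the bit other than \<open>c\<close>.
  With the convention for \<open>*\<close>, all adjacency conditions become one rule:
  \<open>w\<^sub>c(\<gamma>c) + w\<^sub>c\<^sub>'(\<gamma>c) = w\<^sub>c\<^sub>'(*) w\<^sub>c(\<gamma>)\<close>. Applying it along \<open>\<gamma>c, \<gamma>cc', \<gamma>cc'c', \<dots>\<close> gives a
  telescoping sum (\<open>telescoping\<close>):
  \<open>(\<Sum>t\<le>k. w\<^sub>c(*)\<^sup>k\<^sup>-\<^sup>t w\<^sub>c(\<gamma>cc'\<^sup>t)) + w\<^sub>c\<^sub>'(\<gamma>cc'\<^sup>k) = w\<^sub>c(*)\<^sup>k w\<^sub>c\<^sub>'(*) w\<^sub>c(\<gamma>)\<close>.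

  Everything rests on the expression
  \<open>E\<^sub>c(k,\<gamma>,\<delta>) = w\<^sub>c(*)\<^sup>k w\<^sub>c\<^sub>'(*) w\<^sub>c(\<gamma>) w\<^sub>c(\<delta>)\<close>, which is symmetric in \<open>\<gamma>\<close> and \<open>\<delta>\<close>. The sums
  that define \<open>\<zeta>\<^sub>L\<close> and \<open>\<zeta>\<^sub>R\<close> are the left side of the telescoping identity, so
  \<open>\<zeta>\<^sub>L(\<alpha>) + \<zeta>\<^sub>R(\<alpha>) = E\<^sub>c(s\<^sub>n, \<mu>\<^sub>a\<^sub>,\<^sub>n\<^sub>-\<^sub>1(s), *)\<close> (\<open>zeta_sum_eq_exchange\<close>). For \<open>0 < i < n\<close> and a
  \<open>\<delta>\<close> in \<open>\<Delta>\<^sub>n\<close>, multiplying the telescoping identity by \<open>w\<^sub>c(\<delta>)\<close> shows that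
  \<open>E\<^sub>c(s\<^sub>i, \<mu>\<^sub>a\<^sub>,\<^sub>i\<^sub>-\<^sub>1(s), \<delta>)\<close> equals \<open>w\<^sub>c(\<delta>) w\<^sub>c\<^sub>'(\<mu>\<^sub>a\<^sub>,\<^sub>i(s))\<close> up to a polynomial in the entries of
  \<open>w\<^sub>c\<close> alone (\<open>exchange_equiv_product\<close>). This product has one factor from each end of the edge, so
  it can be rewritten a second time with the factors in opposite roles. Taking
  \<open>\<delta> = \<mu>\<^sub>b\<^sub>,\<^sub>n\<^sub>-\<^sub>i(s'')\<close>, the two rewritings together with the symmetry of \<open>E\<close> remove a block from the
  word built from \<open>s\<close> and append it to the one built from \<open>s''\<close> (\<open>exchange_step\<close>). The condition
  \<open>a = b\<close> iff \<open>n\<close> is odd makes the bits of the two words fit.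

  The moved exponents may be changed modulo \<open>q - 1\<close>, because \<open>x\<^sup>k = x\<^sup>k\<^sup>'\<close> in the field as soon as
  \<open>k\<close> and \<open>k'\<close> are congruent and either both zero or both positive. For the first and the last block
  one of \<open>\<gamma>\<close>, \<open>\<delta>\<close> is \<open>*\<close>, which raises the exponent by one and makes positivity automatic.
  Moving all blocks carries \<open>\<mu>\<^sub>a\<^sub>,\<^sub>n\<^sub>+\<^sub>1(s)\<close> to \<open>\<mu>\<^sub>b\<^sub>,\<^sub>n\<^sub>+\<^sub>1(s'')\<close>. For \<open>\<mu>\<^sub>a\<^sub>,\<^sub>n\<^sub>+\<^sub>1(s')\<close> the blocks beyond
  the first difference \<open>m\<close> are moved over from \<open>s\<close> and from \<open>s'\<close> alike. Both then reach \<open>E\<close> with the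
  same \<open>\<gamma>\<close> and \<open>\<delta>\<close> and with the interchangeable exponents \<open>s\<^sub>m\<close> and \<open>s'\<^sub>m\<close>. For this,
  \<open>\<mu>\<^sub>b\<^sub>,\<^sub>n\<^sub>-\<^sub>m(s'')\<close> must be an index.
\<close>

section \<open>Powers in a finite field\<close>

text \<open>Multiplication by \<open>x\<close> permutes the nonzero elements, so it preserves their product.\<close>
lemma power_card_minus_one:
  fixes x :: "'a::{field,finite}"
  assumes "x \<noteq> 0"
  shows "x ^ (CARD('a) - 1) = 1"
proof -
  let ?U = "UNIV - {0 :: 'a}"
  have "bij_betw ((*) x) ?U ?U"
    by (rule bij_betwI[where g = "\<lambda>y. y / x"]) (use assms in auto)
  then have "(\<Prod>y\<in>?U. y) = (\<Prod>y\<in>?U. x * y)"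
    by (rule prod.reindex_bij_betw[symmetric])
  also have "\<dots> = x ^ (CARD('a) - 1) * (\<Prod>y\<in>?U. y)"
    by (simp add: prod.distrib card_Diff_singleton)
  finally show ?thesis by simp
qed

lemma power_cong_mod_card:
  fixes x :: "'a::{field,finite}"
  assumes "[k = k'] (mod (CARD('a) - 1))" and "k = 0 \<longleftrightarrow> k' = 0"
  shows "x ^ k = x ^ k'"
proof (cases "x = 0")
  case True
  then show ?thesis using assms(2) by (simp add: power_0_left)
next
  case False
  have reduce: "x ^ m = x ^ (m mod (CARD('a) - 1))" for m
  proof -
    have "x ^ m = x ^ ((CARD('a) - 1) * (m div (CARD('a) - 1)) + m mod (CARD('a) - 1))"
      by simp
    then show ?thesis
      by (simp only: power_add power_mult power_card_minus_one[OF False] power_one mult_1)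
  qed
  show ?thesis
    using reduce[of k] reduce[of k'] assms(1) by (simp add: cong_def)
qed

section \<open>Functions given by polynomials\<close>

definition monomial_value :: "('v \<Rightarrow>\<^sub>0 nat) \<Rightarrow> ('v \<Rightarrow> 'a::comm_semiring_1) \<Rightarrow> 'a" where
  "monomial_value m x =
     (\<Prod>v\<in>Poly_Mapping.keys m. x v ^ Poly_Mapping.lookup m v)"

lemma monomial_value_superset:
  assumes "finite V" and "Poly_Mapping.keys m \<subseteq> V"
  shows "monomial_value m x = (\<Prod>v\<in>V. x v ^ Poly_Mapping.lookup m v)"
  unfolding monomial_value_def
  by (rule prod.mono_neutral_left) (use assms in \<open>auto simp: in_keys_iff\<close>)

lemma monomial_value_single: "monomial_value (Poly_Mapping.single v k) x = x v ^ k"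
  by (subst monomial_value_superset[of "{v}"]) auto

lemma monomial_value_add:
  "monomial_value (m + m') x = monomial_value m x * monomial_value m' x"
proof -
  let ?V = "Poly_Mapping.keys m \<union> Poly_Mapping.keys m'"
  show ?thesis
    by (simp add: monomial_value_superset[of ?V] keys_add lookup_add power_add prod.distrib)
qed

lemma mpoly_eval_superset:
  assumes "finite M" and "Poly_Mapping.keys p \<subseteq> M"
  shows "mpoly_eval p x = (\<Sum>m\<in>M. Poly_Mapping.lookup p m * monomial_value m x)"
  unfolding mpoly_eval_def monomial_value_def[symmetric]
  by (rule sum.mono_neutral_left) (use assms in \<open>auto simp: in_keys_iff\<close>)

lemma mpoly_eval_add: "mpoly_eval (p + p') x = mpoly_eval p x + mpoly_eval p' x"
proof -
  let ?M = "Poly_Mapping.keys p \<union> Poly_Mapping.keys p'"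
  show ?thesis
    by (simp add: mpoly_eval_superset[of ?M] keys_add lookup_add distrib_right sum.distrib)
qed

lemma mpoly_eval_uminus:
  fixes p :: "('v, 'a::comm_ring_1) mpoly"
  shows "mpoly_eval (- p) x = - mpoly_eval p x"
  by (simp add: mpoly_eval_def keys_minus sum_negf)

lemma mpoly_eval_single:
  "mpoly_eval (Poly_Mapping.single m c) x = c * monomial_value m x"
  by (subst mpoly_eval_superset[of "{m}"]) auto

lemma mpoly_vars_add: "mpoly_vars (p + p') \<subseteq> mpoly_vars p \<union> mpoly_vars p'"
  using keys_add[of p p'] by (auto simp: mpoly_vars_def)

definition polynomial_in :: "'v set \<Rightarrow> (('v \<Rightarrow> 'a::comm_semiring_1) \<Rightarrow> 'a) \<Rightarrow> bool" where
  "polynomial_in D h \<longleftrightarrow> (\<exists>p. mpoly_vars p \<subseteq> D \<and> (\<forall>x. mpoly_eval p x = h x))"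

lemma polynomial_in_zero: "polynomial_in D (\<lambda>x. 0)"
  unfolding polynomial_in_def
  by (rule exI[of _ 0]) (simp add: mpoly_vars_def mpoly_eval_def)

lemma polynomial_in_add:
  assumes "polynomial_in D h" and "polynomial_in D h'"
  shows "polynomial_in D (\<lambda>x. h x + h' x)"
proof -
  obtain p p' where "mpoly_vars p \<subseteq> D" "\<forall>x. mpoly_eval p x = h x"
    and "mpoly_vars p' \<subseteq> D" "\<forall>x. mpoly_eval p' x = h' x"
    using assms by (auto simp: polynomial_in_def)
  then show ?thesis
    unfolding polynomial_in_def using mpoly_vars_add[of p p']
    by (intro exI[of _ "p + p'"]) (auto simp: mpoly_eval_add)
qed

lemma polynomial_in_uminus:
  fixes h :: "('v \<Rightarrow> 'a::comm_ring_1) \<Rightarrow> 'a"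
  assumes "polynomial_in D h"
  shows "polynomial_in D (\<lambda>x. - h x)"
proof -
  obtain p where "mpoly_vars p \<subseteq> D" "\<forall>x. mpoly_eval p x = h x"
    using assms by (auto simp: polynomial_in_def)
  then show ?thesis
    unfolding polynomial_in_def
    by (intro exI[of _ "- p"]) (auto simp: mpoly_eval_uminus mpoly_vars_def keys_minus)
qed

text \<open>The remainders that arise below are sums of monomials of this shape.\<close>
lemma polynomial_in_monomial:
  assumes "u \<in> D" and "v \<in> D" and "w \<in> D"
  shows "polynomial_in D (\<lambda>x. x u ^ k * x v * x w :: 'a::comm_semiring_1)"
proof -
  let ?m = "Poly_Mapping.single u k + Poly_Mapping.single v 1 + Poly_Mapping.single w (1::nat)"
  let ?p = "Poly_Mapping.single ?m (1::'a)"
  have "Poly_Mapping.keys ?m \<subseteq> {u, v, w}"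
    by (intro order.trans[OF keys_add] Un_least) auto
  then have "mpoly_vars ?p \<subseteq> D"
    using assms by (auto simp: mpoly_vars_def)
  moreover have "mpoly_eval ?p x = x u ^ k * x v * x w" for x
    by (simp add: mpoly_eval_single monomial_value_add monomial_value_single)
  ultimately show ?thesis
    unfolding polynomial_in_def by blast
qed

section \<open>Equality up to separated polynomials\<close>

text \<open>
  The bits 0 and 1 select the left and the right end of an edge, in accordance with the role that
  they play in the adjacency conditions.
\<close>
definition side :: "(index \<Rightarrow> 'a) \<Rightarrow> (index \<Rightarrow> 'a) \<Rightarrow> bool \<Rightarrow> index \<Rightarrow> 'a" where
  "side l r c = (if c then r else l)"

text \<open>
  Functions of an edge are functions of its \<open>side\<close> map; \<open>separable\<close> is the property of having the form
  \<open>f + g\<close> that the right side of the theorem allows.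
\<close>
definition separable ::
    "nat \<Rightarrow> bool list set \<Rightarrow> ((bool \<Rightarrow> index \<Rightarrow> 'a::field) \<Rightarrow> 'a) \<Rightarrow> bool" where
  "separable n \<Omega> h \<longleftrightarrow> (\<exists>f g. polynomial_in (Delta n \<Omega>) f \<and> polynomial_in (Delta n \<Omega>) g \<and>
     (\<forall>l r. adjacent \<Omega> l r \<longrightarrow> h (side l r) = f l + g r))"

lemma separable_zero: "separable n \<Omega> (\<lambda>z. 0)"
  unfolding separable_def
  by (intro exI[of _ "\<lambda>x. 0"]) (simp add: polynomial_in_zero)

lemma separable_add:
  assumes "separable n \<Omega> h" and "separable n \<Omega> h'"
  shows "separable n \<Omega> (\<lambda>z. h z + h' z)"
proof -
  obtain f g where "polynomial_in (Delta n \<Omega>) f" "polynomial_in (Delta n \<Omega>) g"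
    and "\<forall>l r. adjacent \<Omega> l r \<longrightarrow> h (side l r) = f l + g r"
    using assms(1) unfolding separable_def by blast
  moreover obtain f' g' where "polynomial_in (Delta n \<Omega>) f'" "polynomial_in (Delta n \<Omega>) g'"
    and "\<forall>l r. adjacent \<Omega> l r \<longrightarrow> h' (side l r) = f' l + g' r"
    using assms(2) unfolding separable_def by blast
  ultimately show ?thesis
    unfolding separable_def
    by (intro exI[of _ "\<lambda>x. f x + f' x"] exI[of _ "\<lambda>x. g x + g' x"])
      (auto intro: polynomial_in_add)
qed

lemma separable_uminus:
  assumes "separable n \<Omega> h"
  shows "separable n \<Omega> (\<lambda>z. - h z)"
proof -
  obtain f g where "polynomial_in (Delta n \<Omega>) f" "polynomial_in (Delta n \<Omega>) g"
    and "\<forall>l r. adjacent \<Omega> l r \<longrightarrow> h (side l r) = f l + g r"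
    using assms unfolding separable_def by blast
  then show ?thesis
    unfolding separable_def
    by (intro exI[of _ "\<lambda>x. - f x"] exI[of _ "\<lambda>x. - g x"]) (auto intro: polynomial_in_uminus)
qed

lemma separable_sum:
  assumes "finite A" and "\<And>i. i \<in> A \<Longrightarrow> separable n \<Omega> (h i)"
  shows "separable n \<Omega> (\<lambda>z. \<Sum>i\<in>A. h i z)"
  using assms by (induction A) (auto intro: separable_zero separable_add)

lemma separable_one_side:
  assumes "polynomial_in (Delta n \<Omega>) p"
  shows "separable n \<Omega> (\<lambda>z. p (z c))"
  unfolding separable_def
  using assms polynomial_in_zero[of "Delta n \<Omega>"]
  by (intro exI[of _ "if c then (\<lambda>x. 0) else p"] exI[of _ "if c then p else (\<lambda>x. 0)"])
    (auto simp: side_def)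

lemma separable_edges_cong:
  assumes "separable n \<Omega> h"
    and "\<And>l r. adjacent \<Omega> l r \<Longrightarrow> h' (side l r) = h (side l r)"
  shows "separable n \<Omega> h'"
  using assms unfolding separable_def by metis

definition equiv_mod ::
    "nat \<Rightarrow> bool list set \<Rightarrow> ((bool \<Rightarrow> index \<Rightarrow> 'a::field) \<Rightarrow> 'a) \<Rightarrow>
     ((bool \<Rightarrow> index \<Rightarrow> 'a) \<Rightarrow> 'a) \<Rightarrow> bool" where
  "equiv_mod n \<Omega> h h' \<longleftrightarrow> separable n \<Omega> (\<lambda>z. h z - h' z)"

lemma equiv_mod_refl: "equiv_mod n \<Omega> h h"
  by (simp add: equiv_mod_def separable_zero)

lemma equiv_mod_sym: "equiv_mod n \<Omega> h h' \<Longrightarrow> equiv_mod n \<Omega> h' h"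
  unfolding equiv_mod_def by (drule separable_uminus) simp

lemma equiv_mod_trans:
  assumes "equiv_mod n \<Omega> h h'" and "equiv_mod n \<Omega> h' h''"
  shows "equiv_mod n \<Omega> h h''"
  using separable_add[OF assms[unfolded equiv_mod_def]] by (simp add: equiv_mod_def)

section \<open>Run lengths of binary words\<close>

text \<open>
  The word with \<open>n\<close> maximal constant runs of lengths \<open>s\<^sub>1 + 1, \<dots>, s\<^sub>n + 1\<close>. The block that
  \<open>mu\<close> appends last starts by finishing a run and otherwise begins the next one, which is why \<open>mu\<close>
  lags behind by one run. In this form the parameters can be read off the word.
\<close>
primrec runs :: "nat \<Rightarrow> nat \<Rightarrow> (nat \<Rightarrow> nat) \<Rightarrow> bool list" where
  "runs a 0 s = []"
| "runs a (Suc i) s = runs a i s @ replicate (Suc (s (Suc i))) (even (Suc i + a))"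

lemma append_bits_assoc: "\<gamma> \<frown> (x # xs) \<frown> ys = \<gamma> \<frown> (x # xs @ ys)"
  by (cases \<gamma>) auto

lemma mu_Suc:
  "mu a (Suc i) s = mu a i s \<frown> (odd (Suc i + a) # replicate (s (Suc i)) (even (Suc i + a)))"
  by simp

lemma mu_Suc_eq_runs:
  "mu a (Suc i) s = Seq (runs a i s @ replicate (s (Suc i)) (even (Suc i + a)))"
proof (induction i)
  case (Suc i)
  then show ?case
    by (simp add: replicate_append_same del: replicate_Suc)
       (simp add: replicate_append_same)
qed simp

lemma mu_cong: "(\<And>j. 1 \<le> j \<Longrightarrow> j \<le> i \<Longrightarrow> s j = s' j) \<Longrightarrow> mu a i s = mu a i s'"
  by (induction i) auto

lemma runs_cong: "(\<And>j. 1 \<le> j \<Longrightarrow> j \<le> i \<Longrightarrow> s j = s' j) \<Longrightarrow> runs a i s = runs a i s'"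
  by (induction i) auto

lemma decomposition_iff_runs:
  "decomposition \<alpha> a n s \<longleftrightarrow> a \<in> {0, 1} \<and> n \<ge> 1 \<and> s (n + 1) = 0 \<and> \<alpha> = runs a n s"
  using mu_Suc_eq_runs[of a n s] by (auto simp: decomposition_def)

lemma runs_eq_Nil_iff: "runs a n s = [] \<longleftrightarrow> n = 0"
  by (cases n) auto

lemma last_runs: "n \<ge> 1 \<Longrightarrow> last (runs a n s) = even (n + a)"
  by (cases n) auto

lemma append_replicate_unique:
  assumes "xs @ replicate k c = ys @ replicate k' c"
    and "xs \<noteq> [] \<Longrightarrow> last xs \<noteq> c" and "ys \<noteq> [] \<Longrightarrow> last ys \<noteq> c"
  shows "xs = ys \<and> k = k'"
proof -
  have strip: "dropWhile ((=) c) (rev zs) = rev zs" if "zs \<noteq> [] \<Longrightarrow> last zs \<noteq> c" for zs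
    using that by (cases zs rule: rev_cases) auto
  have drop: "dropWhile ((=) c) (rev (zs @ replicate j c)) = rev zs"
    if "zs \<noteq> [] \<Longrightarrow> last zs \<noteq> c" for zs j
    using strip[OF that] by (induction j) (auto simp: replicate_append_same)
  have "rev xs = rev ys"
    using drop[OF assms(2), of k] drop[OF assms(3), of k'] assms(1) by simp
  then show ?thesis using assms(1) by (auto dest: arg_cong[of _ _ length])
qed

text \<open>
  The last run of a word determines its own length and the rest of the word; induct on the number
  of runs.
\<close>
lemma runs_unique:
  assumes "runs a n s = runs a' n' s'"
  shows "n = n' \<and> (\<forall>i\<in>{1..n}. s i = s' i)"
  using assms
proof (induction n arbitrary: n')
  case 0
  then show ?case using runs_eq_Nil_iff[of a' n' s'] by auto
next
  case (Suc n)
  then obtain k where k: "n' = Suc k"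
    using runs_eq_Nil_iff[of a "Suc n" s] by (cases n') auto
  have parity: "even (Suc n + a) = even (Suc k + a')"
    using last_runs[of "Suc n" a s] last_runs[of "Suc k" a' s'] Suc.prems k
    by (simp del: runs.simps)
  have "runs a n s = runs a' k s' \<and> Suc (s (Suc n)) = Suc (s' (Suc k))"
  proof (rule append_replicate_unique[where c = "even (Suc n + a)"])
    show "runs a n s @ replicate (Suc (s (Suc n))) (even (Suc n + a)) =
          runs a' k s' @ replicate (Suc (s' (Suc k))) (even (Suc n + a))"
      using Suc.prems k parity by simp
    show "last (runs a n s) \<noteq> even (Suc n + a)" if "runs a n s \<noteq> []"
      using that by (cases n) auto
    show "last (runs a' k s') \<noteq> even (Suc n + a)" if "runs a' k s' \<noteq> []"
      unfolding parity using that by (cases k) auto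
  qed
  with Suc.IH[of k] k show ?case by (auto simp: le_Suc_eq)
qed

lemma decomposition_unique:
  assumes "decomposition \<alpha> a n s" and "decomposition \<alpha> a' n' s'"
  shows "a = a' \<and> n = n' \<and> (\<forall>i\<in>{1..n}. s i = s' i)"
proof -
  have *: "a \<in> {0, 1}" "a' \<in> {0, 1}" "n \<ge> 1" "n' \<ge> 1" "\<alpha> = runs a n s" "\<alpha> = runs a' n' s'"
    using assms by (auto simp: decomposition_iff_runs)
  then have "n = n' \<and> (\<forall>i\<in>{1..n}. s i = s' i)"
    using runs_unique by metis
  moreover have "even (n + a) = even (n' + a')"
    using last_runs[of n a s] last_runs[of n' a' s'] * by simp
  ultimately show ?thesis using * by auto
qed

lemma kappa_eq: "decomposition \<alpha> a n s \<Longrightarrow> kappa \<alpha> = n"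
  unfolding kappa_def using decomposition_unique by (intro the_equality) blast+

text \<open>
  Evaluates a definite description over all decompositions. The sequence is determined only in its
  entries \<open>1, \<dots>, n\<close>, hence the second premise.
\<close>
lemma the_decomposition:
  assumes "decomposition \<alpha> a n s"
    and "\<And>s'. decomposition \<alpha> a n s' \<Longrightarrow> (\<forall>i\<in>{1..n}. s' i = s i) \<Longrightarrow> F a n s' = F a n s"
  shows "(THE v. \<exists>a n s. decomposition \<alpha> a n s \<and> v = F a n s) = F a n s"
proof (rule the_equality)
  show "\<exists>a' n' s'. decomposition \<alpha> a' n' s' \<and> F a n s = F a' n' s'"
    using assms(1) by blast
  show "v = F a n s" if "\<exists>a n s. decomposition \<alpha> a n s \<and> v = F a n s" for v
  proof -
    obtain a' n' s' where *: "decomposition \<alpha> a' n' s'" and v: "v = F a' n' s'"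
      using \<open>\<exists>a n s. decomposition \<alpha> a n s \<and> v = F a n s\<close> by blast
    have "a = a' \<and> n = n' \<and> (\<forall>i\<in>{1..n}. s i = s' i)"
      by (rule decomposition_unique[OF assms(1) *])
    then show ?thesis using assms(2)[of s'] * v by auto
  qed
qed

lemma zeta_L_eq:
  assumes "decomposition \<alpha> a n s"
  shows "zeta_L \<alpha> l = (if even (n + a)
          then \<Sum>t = 0..s n + 1. l Star ^ (s n + 1 - t) *
                 l (mu a (n - 1) s \<frown> (False # replicate t True))
          else l (Seq \<alpha>))"
  unfolding zeta_L_def
proof (rule the_decomposition[OF assms], goal_cases)
  case (1 s')
  moreover have "mu a (n - 1) s' = mu a (n - 1) s" and "s' n = s n"
    using 1 assms by (auto intro!: mu_cong simp: decomposition_def)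
  ultimately show ?case by simp
qed

lemma zeta_R_eq:
  assumes "decomposition \<alpha> a n s"
  shows "zeta_R \<alpha> r = (if odd (n + a)
          then \<Sum>t = 0..s n + 1. r Star ^ (s n + 1 - t) *
                 r (mu a (n - 1) s \<frown> (True # replicate t False))
          else r (Seq \<alpha>))"
  unfolding zeta_R_def
proof (rule the_decomposition[OF assms], goal_cases)
  case (1 s')
  moreover have "mu a (n - 1) s' = mu a (n - 1) s" and "s' n = s n"
    using 1 assms by (auto intro!: mu_cong simp: decomposition_def)
  ultimately show ?case by simp
qed

section \<open>Prefixes and small indices\<close>

lemma C1_prefix: "C1 \<Omega> \<Longrightarrow> xs @ ys \<in> \<Omega> \<Longrightarrow> xs \<in> \<Omega>"
proof (induction ys rule: rev_induct)
  case (snoc y ys)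
  then have "butlast (xs @ ys @ [y]) \<in> \<Omega>" unfolding C1_def by blast
  then show ?case using snoc by (simp add: butlast_append)
qed simp

lemma indices_prefix:
  assumes "C1 \<Omega>" and "\<gamma> \<frown> xs \<in> indices \<Omega>"
  shows "\<gamma> \<in> indices \<Omega>"
  using assms C1_prefix[OF assms(1)] by (cases \<gamma>) (auto simp: indices_def)

lemma mu_prefix:
  assumes "C1 \<Omega>" and "i \<le> j" and "mu a j s \<in> indices \<Omega>"
  shows "mu a i s \<in> indices \<Omega>"
  using assms(2)
proof (induction rule: inc_induct)
  case base
  show ?case by (fact assms(3))
next
  case (step i)
  then show ?case using indices_prefix[OF assms(1), of "mu a i s"] by (simp only: mu_Suc)
qed

corollary mu_prefix_of_word:
  assumes "C1 \<Omega>" and "\<alpha> \<in> \<Omega>" and "Seq \<alpha> = mu a j s" and "i \<le> j"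
  shows "mu a i s \<in> indices \<Omega>"
proof (rule mu_prefix[OF assms(1,4)])
  show "mu a j s \<in> indices \<Omega>"
    unfolding assms(3)[symmetric] using assms(2) by (simp add: indices_def)
qed

text \<open>
  For \<open>i > 0\<close> the index \<open>mu a i s\<close> has \<open>i\<close> runs if \<open>s\<^sub>i > 0\<close> and \<open>i - 1\<close> runs otherwise, the number of runs being
  \<open>kappa\<close>.
\<close>
lemma mu_in_Delta:
  assumes "a \<in> {0, 1}" and "i < n" and "mu a i s \<in> indices \<Omega>"
  shows "mu a i s \<in> Delta n \<Omega>"
proof (cases i)
  case 0
  then show ?thesis by (simp add: Delta_def)
next
  case (Suc j)
  show ?thesis
  proof (cases "s i")
    case 0
    then have eq: "mu a i s = Seq (runs a j s)"
      using Suc mu_Suc_eq_runs[of a j s] by simp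
    show ?thesis
    proof (cases j)
      case 0
      then show ?thesis using eq by (simp add: Delta_def)
    next
      case (Suc k)
      have "decomposition (runs a j s) a j s"
        using assms(1) Suc 0 \<open>i = Suc j\<close> by (simp add: decomposition_iff_runs)
      then have "kappa (runs a j s) < n"
        using kappa_eq assms(2) \<open>i = Suc j\<close> by fastforce
      then show ?thesis
        using eq assms(3) runs_eq_Nil_iff[of a j s] Suc by (auto simp: Delta_def indices_def)
    qed
  next
    case (Suc k)
    let ?s = "s(i := k, Suc i := 0)"
    have eq: "mu a i s = Seq (runs a i ?s)"
      using Suc \<open>i = Suc j\<close> mu_Suc_eq_runs[of a j s] runs_cong[of j ?s s a] by simp
    have "decomposition (runs a i ?s) a i ?s"
      using assms(1) \<open>i = Suc j\<close> by (simp add: decomposition_iff_runs)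
    then have "kappa (runs a i ?s) < n"
      using kappa_eq assms(2) by fastforce
    then show ?thesis
      using eq assms(3) runs_eq_Nil_iff[of a i ?s] \<open>i = Suc j\<close>
      by (auto simp: Delta_def indices_def)
  qed
qed

section \<open>Moving a block from one word to the other\<close>

text \<open>
  The three adjacency conditions in a single form: the first one is the case \<open>\<gamma> = *\<close>, which yields
  the same equation for both bits.
\<close>
lemma adjacent_side:
  assumes "adjacent \<Omega> l r" and "\<gamma> \<frown> [c] \<in> indices \<Omega>"
  shows "side l r c (\<gamma> \<frown> [c]) + side l r (\<not> c) (\<gamma> \<frown> [c]) =
         side l r (\<not> c) Star * side l r c \<gamma>"
  using assms by (cases \<gamma>; cases c) (auto simp: side_def adjacent_def indices_def ac_simps)

text \<open>
  Appending one more \<open>\<not> c\<close> multiplies the left side by \<open>z c Star\<close>: the two new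
  values at the longer index add up to \<open>z c Star\<close> times the previous last term, by the adjacency
  condition for the bit \<open>\<not> c\<close>.
\<close>
lemma telescoping:
  assumes "C1 \<Omega>" and "adjacent \<Omega> l r" and "z = side l r"
    and "\<gamma> \<frown> (c # replicate k (\<not> c)) \<in> indices \<Omega>"
  shows "(\<Sum>t = 0..k. z c Star ^ (k - t) * z c (\<gamma> \<frown> (c # replicate t (\<not> c)))) +
           z (\<not> c) (\<gamma> \<frown> (c # replicate k (\<not> c))) =
         z c Star ^ k * z (\<not> c) Star * z c \<gamma>"
  using assms(4)
proof (induction k)
  case 0
  then show ?case using adjacent_side[OF assms(2), of \<gamma> c] assms(3) by simp
next
  case (Suc k)
  let ?X = "z c Star" and ?e = "\<lambda>t. \<gamma> \<frown> (c # replicate t (\<not> c))"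
  have e: "?e (Suc k) = ?e k \<frown> [\<not> c]"
    by (simp add: append_bits_assoc replicate_append_same)
  have IH: "(\<Sum>t = 0..k. ?X ^ (k - t) * z c (?e t)) + z (\<not> c) (?e k) =
            ?X ^ k * z (\<not> c) Star * z c \<gamma>"
    using Suc e indices_prefix[OF assms(1)] by simp
  have "z (\<not> c) (?e (Suc k)) + z c (?e (Suc k)) = ?X * z (\<not> c) (?e k)"
    using adjacent_side[OF assms(2), of "?e k" "\<not> c"] Suc.prems e assms(3) by simp
  moreover have "(\<Sum>t = 0..Suc k. ?X ^ (Suc k - t) * z c (?e t)) =
      ?X * (\<Sum>t = 0..k. ?X ^ (k - t) * z c (?e t)) + z c (?e (Suc k))"
    by (simp add: sum_distrib_left Suc_diff_le mult.assoc)
  ultimately have "(\<Sum>t = 0..Suc k. ?X ^ (Suc k - t) * z c (?e t)) + z (\<not> c) (?e (Suc k)) =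
      ?X * ((\<Sum>t = 0..k. ?X ^ (k - t) * z c (?e t)) + z (\<not> c) (?e k))"
    by (simp add: algebra_simps)
  then show ?case unfolding IH by (simp add: ac_simps)
qed

text \<open>
  The expression called \<open>E\<^sub>c(k,\<gamma>,\<delta>)\<close> in the introduction, as a function of the edge. It is where a
  block \<open>c(\<not> c)\<^sup>k\<close> can be attached to \<open>\<gamma>\<close> or, equally well, to \<open>\<delta>\<close>.
\<close>
definition exchange ::
    "bool \<Rightarrow> nat \<Rightarrow> index \<Rightarrow> index \<Rightarrow> (bool \<Rightarrow> index \<Rightarrow> 'a::field) \<Rightarrow> 'a" where
  "exchange c k \<gamma> \<delta> z = z c Star ^ k * z (\<not> c) Star * z c \<gamma> * z c \<delta>"

lemma exchange_commute: "exchange c k \<gamma> \<delta> = exchange c k \<delta> \<gamma>"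
  by (simp add: exchange_def fun_eq_iff ac_simps)

text \<open>
  If \<open>\<gamma>\<close> or \<open>\<delta>\<close> is \<open>*\<close>, the exponent of \<open>z c Star\<close> is really \<open>k + 1\<close> and cannot vanish.
\<close>
lemma exchange_cong_exponent:
  fixes z :: "bool \<Rightarrow> index \<Rightarrow> 'a::{field,finite}"
  assumes "[k = k'] (mod (CARD('a) - 1))"
    and "(k = 0 \<longleftrightarrow> k' = 0) \<or> \<gamma> = Star \<or> \<delta> = Star"
  shows "exchange c k \<gamma> \<delta> z = exchange c k' \<gamma> \<delta> z"
  using assms(2)
proof
  assume "k = 0 \<longleftrightarrow> k' = 0"
  then show ?thesis using power_cong_mod_card[OF assms(1)] by (simp add: exchange_def)
next
  have "[Suc k = Suc k'] (mod (CARD('a) - 1))"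
    using cong_add[OF cong_refl[of 1] assms(1)] by simp
  then have "z c Star ^ Suc k = z c Star ^ Suc k'"
    by (rule power_cong_mod_card) simp
  moreover assume "\<gamma> = Star \<or> \<delta> = Star"
  ultimately show ?thesis by (auto simp: exchange_def ac_simps)
qed

text \<open>
  The sum in whichever of \<open>zeta_L\<close>, \<open>zeta_R\<close> carries one is the telescoping sum of length \<open>s\<^sub>n + 1\<close>,
  and the other of the two is the leftover term of the telescoping identity.
\<close>
lemma zeta_sum_eq_exchange:
  assumes "C1 \<Omega>" and "adjacent \<Omega> l r" and "\<alpha> \<in> \<Omega>" and "decomposition \<alpha> a n s"
  shows "zeta_L \<alpha> l + zeta_R \<alpha> r =
         exchange (odd (n + a)) (s n) (mu a (n - 1) s) Star (side l r)"
proof -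
  let ?c = "odd (n + a)" and ?\<gamma> = "mu a (n - 1) s" and ?z = "side l r"
  obtain m where m: "n = Suc m" using assms(4) by (cases n) (auto simp: decomposition_def)
  have \<alpha>: "Seq \<alpha> = ?\<gamma> \<frown> (?c # replicate (s n + 1) (\<not> ?c))"
    using assms(4) m by (simp add: decomposition_def append_bits_assoc replicate_append_same)
  have "zeta_L \<alpha> l + zeta_R \<alpha> r =
      (\<Sum>t = 0..s n + 1. ?z ?c Star ^ (s n + 1 - t) * ?z ?c (?\<gamma> \<frown> (?c # replicate t (\<not> ?c)))) +
      ?z (\<not> ?c) (Seq \<alpha>)"
    unfolding zeta_L_eq[OF assms(4)] zeta_R_eq[OF assms(4)]
    by (cases "even (n + a)") (simp_all add: side_def add.commute)
  also have "\<dots> = ?z ?c Star ^ (s n + 1) * ?z (\<not> ?c) Star * ?z ?c ?\<gamma>"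
    unfolding \<alpha>
  proof (rule telescoping[OF assms(1,2) refl])
    show "?\<gamma> \<frown> (?c # replicate (s n + 1) (\<not> ?c)) \<in> indices \<Omega>"
      unfolding \<alpha>[symmetric] indices_def using assms(3) by simp
  qed
  finally show ?thesis by (simp add: exchange_def ac_simps)
qed

text \<open>
  The difference is the telescoping sum times \<open>z c \<delta>\<close>, which involves one end of the edge only. Its
  indices are of the form \<open>\<mu>\<^sub>a\<^sub>,\<^sub>i(s\<^sub>1, \<dots>, s\<^sub>i\<^sub>-\<^sub>1, t)\<close>, so \<open>i < n\<close> puts them into \<open>Delta\<close>.
\<close>
lemma exchange_equiv_product:
  assumes "C1 \<Omega>" and "a \<in> {0, 1}" and "1 \<le> i" and "i < n"
    and "mu a i s \<in> indices \<Omega>" and "\<delta> \<in> Delta n \<Omega>" and "c = odd (i + a)"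
  shows "equiv_mod n \<Omega> (exchange c (s i) (mu a (i - 1) s) \<delta>)
           (\<lambda>z. z c \<delta> * z (\<not> c) (mu a i s))"
proof -
  let ?e = "\<lambda>t. mu a i (s(i := t))"
  obtain j where i: "i = Suc j" using assms(3) by (cases i) auto
  have e: "?e t = mu a (i - 1) s \<frown> (c # replicate t (\<not> c))" for t
    using mu_cong[of j "s(i := t)" s a] i assms(7) by simp
  have e_self: "mu a i s = mu a (i - 1) s \<frown> (c # replicate (s i) (\<not> c))"
    using e[of "s i"] by (simp only: fun_upd_triv)
  have Star: "Star \<in> Delta n \<Omega>" by (simp add: Delta_def)
  have Delta: "?e t \<in> Delta n \<Omega>" if "t \<le> s i" for t
  proof (rule mu_in_Delta[OF assms(2,4)])
    have "?e (s i) = ?e t \<frown> replicate (s i - t) (\<not> c)"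
      unfolding e append_bits_assoc using that by (simp flip: replicate_add)
    then show "?e t \<in> indices \<Omega>"
      using indices_prefix[OF assms(1)] assms(5) by simp
  qed
  have "separable n \<Omega> (\<lambda>z. \<Sum>t = 0..s i. z c Star ^ (s i - t) * z c (?e t) * z c \<delta>)"
  proof (rule separable_sum)
    fix t assume "t \<in> {0..s i}"
    then have "?e t \<in> Delta n \<Omega>" using Delta by simp
    from separable_one_side[OF polynomial_in_monomial[OF Star this assms(6)]]
    show "separable n \<Omega> (\<lambda>z. z c Star ^ (s i - t) * z c (?e t) * z c \<delta>)" .
  qed simp
  then show ?thesis
    unfolding equiv_mod_def
  proof (rule separable_edges_cong, goal_cases)
    case (1 l r)
    let ?z = "side l r"
    have "(\<Sum>t = 0..s i. ?z c Star ^ (s i - t) * ?z c (?e t)) + ?z (\<not> c) (mu a i s) =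
        ?z c Star ^ s i * ?z (\<not> c) Star * ?z c (mu a (i - 1) s)"
      unfolding e e_self
      by (rule telescoping[OF assms(1) 1 refl]) (use assms(5) e_self in simp)
    then have "(\<Sum>t = 0..s i. ?z c Star ^ (s i - t) * ?z c (?e t)) =
        ?z c Star ^ s i * ?z (\<not> c) Star * ?z c (mu a (i - 1) s) - ?z (\<not> c) (mu a i s)"
      by (rule eq_diff_eq[THEN iffD2])
    then show ?case
      unfolding exchange_def sum_distrib_right[symmetric]
      by (simp only: left_diff_distrib right_diff_distrib mult.commute)
  qed
qed

text \<open>
  Both sides are equivalent to the same product with one factor \<open>mu a i s\<close> and one factor
  \<open>mu b (n - i) u\<close>: on the left the block \<open>i + 1\<close> of \<open>s\<close> is attached to the word of \<open>u\<close>, on the right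
  the block \<open>i\<close> of \<open>s\<close> stays with the word of \<open>s\<close>.
\<close>
lemma exchange_step:
  fixes s u :: "nat \<Rightarrow> nat"
  assumes "C1 \<Omega>" and "a \<in> {0, 1}" and "b \<in> {0, 1}" and "a = b \<longleftrightarrow> odd n"
    and "1 \<le> i" and "i < n"
    and "mu a i s \<in> indices \<Omega>" and "mu b (n - i) u \<in> indices \<Omega>"
    and "[s (Suc i) = u (n - i)] (mod (CARD('a) - 1))"
    and "Suc i < n \<Longrightarrow> s (Suc i) = 0 \<longleftrightarrow> u (n - i) = 0"
  shows "equiv_mod n \<Omega>
     (exchange (odd (Suc i + a)) (s (Suc i)) (mu a i s) (mu b (n - Suc i) u)
        :: (bool \<Rightarrow> index \<Rightarrow> 'a::{field,finite}) \<Rightarrow> 'a)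
     (exchange (odd (i + a)) (s i) (mu a (i - 1) s) (mu b (n - i) u))"
proof -
  let ?c = "odd (i + a)" and ?\<gamma> = "mu a i s" and ?\<delta> = "mu b (n - i) u"
  \<comment> \<open>The block added to the word of \<open>u\<close> must start with the same bit as block \<open>i + 1\<close> of \<open>s\<close>.\<close>
  have parity: "(\<not> ?c) = odd (n - i + b)"
    using assms(2-6) by auto
  have Delta: "?\<gamma> \<in> Delta n \<Omega>" "?\<delta> \<in> Delta n \<Omega>"
    using mu_in_Delta assms by auto
  have "exchange (\<not> ?c) (s (Suc i)) ?\<gamma> (mu b (n - Suc i) u) =
      (exchange (\<not> ?c) (u (n - i)) (mu b (n - i - 1) u) ?\<gamma> :: (bool \<Rightarrow> index \<Rightarrow> 'a) \<Rightarrow> 'a)"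
  proof -
    have "(s (Suc i) = 0 \<longleftrightarrow> u (n - i) = 0) \<or> ?\<gamma> = Star \<or> mu b (n - Suc i) u = Star"
      using assms(6,10) by (cases "Suc i < n") auto
    then have "exchange (\<not> ?c) (s (Suc i)) ?\<gamma> (mu b (n - Suc i) u) z =
        (exchange (\<not> ?c) (u (n - i)) ?\<gamma> (mu b (n - Suc i) u) z :: 'a)" for z
      by (rule exchange_cong_exponent[OF assms(9)])
    then show ?thesis
      unfolding exchange_commute[of _ _ "mu b (n - i - 1) u"] by (auto simp: fun_eq_iff)
  qed
  then have "equiv_mod n \<Omega>
      (exchange (\<not> ?c) (s (Suc i)) ?\<gamma> (mu b (n - Suc i) u) :: (bool \<Rightarrow> index \<Rightarrow> 'a) \<Rightarrow> 'a)
      (\<lambda>z. z (\<not> ?c) ?\<gamma> * z ?c ?\<delta>)"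
    using exchange_equiv_product[OF assms(1,3) _ _ assms(8) Delta(1) parity] assms(5,6)
    by (simp add: Suc_le_eq)
  moreover have "equiv_mod n \<Omega>
      (exchange ?c (s i) (mu a (i - 1) s) ?\<delta> :: (bool \<Rightarrow> index \<Rightarrow> 'a) \<Rightarrow> 'a)
      (\<lambda>z. z (\<not> ?c) ?\<gamma> * z ?c ?\<delta>)"
    using exchange_equiv_product[OF assms(1,2,5,6,7) Delta(2) refl] by (simp add: mult.commute)
  ultimately show ?thesis
    using equiv_mod_trans equiv_mod_sym by fastforce
qed

text \<open>
  All intermediate words are prefixes of \<open>mu a n s\<close> or of \<open>mu b (n - m) u\<close>, so by \<open>C1\<close> it suffices
  that these two are indices.
\<close>
lemma exchange_chain:
  fixes s u :: "nat \<Rightarrow> nat"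
  assumes "C1 \<Omega>" and "a \<in> {0, 1}" and "b \<in> {0, 1}" and "a = b \<longleftrightarrow> odd n"
    and "1 \<le> m" and "m \<le> n"
    and "mu a n s \<in> indices \<Omega>" and "mu b (n - m) u \<in> indices \<Omega>"
    and "\<And>i. 1 \<le> i \<Longrightarrow> i \<le> n \<Longrightarrow> [s i = u (n + 1 - i)] (mod (CARD('a) - 1))"
    and "\<And>i. 1 < i \<Longrightarrow> i < n \<Longrightarrow> s i = 0 \<longleftrightarrow> u (n + 1 - i) = 0"
  shows "equiv_mod n \<Omega>
     (exchange (odd (n + a)) (s n) (mu a (n - 1) s) Star
        :: (bool \<Rightarrow> index \<Rightarrow> 'a::{field,finite}) \<Rightarrow> 'a)
     (exchange (odd (m + a)) (s m) (mu a (m - 1) s) (mu b (n - m) u))"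
  using assms(6)
proof (induction rule: inc_induct)
  case base
  show ?case by (simp add: equiv_mod_refl)
next
  case (step i)
  have "1 \<le> i" using assms(5) step by simp
  have "equiv_mod n \<Omega>
     (exchange (odd (Suc i + a)) (s (Suc i)) (mu a i s) (mu b (n - Suc i) u)
        :: (bool \<Rightarrow> index \<Rightarrow> 'a::{field,finite}) \<Rightarrow> 'a)
     (exchange (odd (i + a)) (s i) (mu a (i - 1) s) (mu b (n - i) u))"
    using step \<open>1 \<le> i\<close> assms(9)[of "Suc i"] assms(10)[of "Suc i"]
      mu_prefix[OF assms(1) _ assms(7), of i] mu_prefix[OF assms(1) _ assms(8), of "n - i"]
    by (intro exchange_step[OF assms(1-4)]) auto
  with step.IH show ?case by (auto intro: equiv_mod_trans)
qed

theorem theorem4: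
  fixes \<Omega> :: "bool list set"
    and n a b :: nat
    and s s' s'' :: "nat \<Rightarrow> nat"
    and \<alpha> \<beta> :: "bool list"
  assumes "finite \<Omega>" and "C1 \<Omega>"
    and "n > 0"
    and "s (n + 1) = 0" and "s' (n + 1) = 0" and "s'' (n + 1) = 0"
    and "\<forall>i\<in>{1..n}. [s i = s' i] (mod (CARD('a) - 1)) \<and>
                     [s' i = s'' (n + 1 - i)] (mod (CARD('a) - 1))"
    and "\<forall>i. 1 < i \<and> i < n \<and> Min {s i, s' i, s'' (n + 1 - i)} = 0 \<longrightarrow>
               s i = s' i \<and> s' i = s'' (n + 1 - i)"
    and "a \<in> {0, 1}" and "b \<in> {0, 1}" and "a = b \<longleftrightarrow> odd n"
    and "Seq \<alpha> = mu a (n + 1) s"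
    and "Seq \<beta> = mu a (n + 1) s' \<or> Seq \<beta> = mu b (n + 1) s''"
    and "\<alpha> \<in> \<Omega>" and "\<beta> \<in> \<Omega>"
    and "\<forall>m\<in>{1..n}. s m \<noteq> s' m \<and> (\<forall>i\<in>{1..<m}. s i = s' i) \<longrightarrow>
               mu b (n - m) s'' \<in> indices \<Omega>"
  shows "\<exists>f g :: (index, 'a::{field,finite}) mpoly.
           mpoly_vars f \<subseteq> Delta n \<Omega> \<and> mpoly_vars g \<subseteq> Delta n \<Omega> \<and>
           (\<forall>l r. (LV l, RV r) \<in> edges \<Omega> \<longrightarrow>
              zeta_L \<alpha> l + zeta_R \<alpha> r - zeta_L \<beta> l - zeta_R \<beta> r =
              mpoly_eval f l + mpoly_eval g r)"
proof -
  have cong: "[s i = s'' (n + 1 - i)] (mod (CARD('a) - 1))" "[s i = s' i] (mod (CARD('a) - 1))"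
    "[s' i = s'' (n + 1 - i)] (mod (CARD('a) - 1))" if "1 \<le> i" "i \<le> n" for i
    using assms(7) that by (auto intro: cong_trans)
  have zero: "s i = 0 \<longleftrightarrow> s'' (n + 1 - i) = 0" "s' i = 0 \<longleftrightarrow> s'' (n + 1 - i) = 0"
    if "1 < i" "i < n" for i
  proof -
    have Min_zero: "Min {x, y, w} = 0 \<longleftrightarrow> x = 0 \<or> y = 0 \<or> w = 0" for x y w :: nat
      by (auto simp: min_def)
    have "s i = 0 \<or> s' i = 0 \<or> s'' (n + 1 - i) = 0 \<Longrightarrow> s i = s' i \<and> s' i = s'' (n + 1 - i)"
      using assms(8)[unfolded Min_zero] that by blast
    then show "s i = 0 \<longleftrightarrow> s'' (n + 1 - i) = 0" "s' i = 0 \<longleftrightarrow> s'' (n + 1 - i) = 0"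
      by fastforce+
  qed
  have \<alpha>: "mu a n s \<in> indices \<Omega>"
    by (rule mu_prefix_of_word[OF assms(2,14,12)]) simp
  have dec: "decomposition \<alpha> a n s"
    using assms(3,4,9,12) by (auto simp: decomposition_def)
  let ?h = "\<lambda>a s. exchange (odd (n + a)) (s n) (mu a (n - 1) s) Star :: (bool \<Rightarrow> index \<Rightarrow> 'a) \<Rightarrow> 'a"
  have "\<exists>a' t. decomposition \<beta> a' n t \<and> equiv_mod n \<Omega> (?h a s) (?h a' t)"
    using assms(13)
  proof
    assume \<beta>: "Seq \<beta> = mu b (n + 1) s''"
    then have "decomposition \<beta> b n s''"
      using assms(3,6,10) by (auto simp: decomposition_def)
    moreover have "mu b (n - 1) s'' \<in> indices \<Omega>"
      by (rule mu_prefix_of_word[OF assms(2,15) \<beta>]) simp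
    then have "equiv_mod n \<Omega> (?h a s)
        (exchange (odd (1 + a)) (s 1) (mu a (1 - 1) s) (mu b (n - 1) s''))"
      using assms(3) cong zero \<alpha> by (intro exchange_chain[OF assms(2,9,10,11)]) auto
    \<comment> \<open>The last remaining block sits next to \<open>*\<close>, so symmetry moves it without another telescoping.\<close>
    moreover have "exchange (odd (1 + a)) (s 1) (mu a (1 - 1) s) (mu b (n - 1) s'') = ?h b s''"
    proof -
      have "odd (1 + a) = odd (n + b)" using assms(9-11) by auto
      then show ?thesis
        using exchange_cong_exponent[OF cong(1)[of 1], where \<gamma> = Star] assms(3)
        unfolding exchange_commute[of _ _ "mu b (n - 1) s''"] by (auto simp: fun_eq_iff)
    qed
    ultimately show ?thesis by (intro exI[of _ b] exI[of _ s'']) simp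
  next
    assume \<beta>: "Seq \<beta> = mu a (n + 1) s'"
    then have "decomposition \<beta> a n s'"
      using assms(3,5,9) by (auto simp: decomposition_def)
    moreover have \<beta>': "mu a n s' \<in> indices \<Omega>"
      by (rule mu_prefix_of_word[OF assms(2,15) \<beta>]) simp
    have "equiv_mod n \<Omega> (?h a s) (?h a s')"
    proof (cases "\<forall>i\<in>{1..n}. s i = s' i")
      case True
      then have "mu a (n - 1) s = mu a (n - 1) s'" "s n = s' n"
        using assms(3) by (auto intro!: mu_cong)
      then show ?thesis by (simp add: equiv_mod_refl)
    next
      case False
      then have "\<exists>m. m \<in> {1..n} \<and> s m \<noteq> s' m" by blast
      from this[unfolded exists_least_iff[where P = "\<lambda>m. m \<in> {1..n} \<and> s m \<noteq> s' m"]]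
      obtain m where m: "m \<in> {1..n}" "s m \<noteq> s' m"
        and below: "\<And>i. i < m \<Longrightarrow> \<not> (i \<in> {1..n} \<and> s i \<noteq> s' i)"
        by blast
      have least: "s i = s' i" if "i \<in> {1..<m}" for i
        using below[of i] m(1) that by auto
      have "mu b (n - m) s'' \<in> indices \<Omega>"
        using assms(16) m least by blast
      then have chain: "equiv_mod n \<Omega> (?h a t)
          (exchange (odd (m + a)) (t m) (mu a (m - 1) t) (mu b (n - m) s''))"
        if "t = s \<or> t = s'" for t
        using that m(1) cong zero \<alpha> \<beta>' by (intro exchange_chain[OF assms(2,9,10,11)]) auto
      have "(s m = 0 \<longleftrightarrow> s' m = 0) \<or> mu a (m - 1) s = Star \<or> mu b (n - m) s'' = Star"
      proof (cases "1 < m \<and> m < n")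
        case True
        then show ?thesis using zero by simp
      next
        case False
        then have "m = 1 \<or> m = n" using m(1) by auto
        then show ?thesis by auto
      qed
      moreover have "mu a (m - 1) s = mu a (m - 1) s'"
        using least by (intro mu_cong) auto
      ultimately have eq: "exchange (odd (m + a)) (s m) (mu a (m - 1) s) (mu b (n - m) s'') =
          (exchange (odd (m + a)) (s' m) (mu a (m - 1) s') (mu b (n - m) s'')
            :: (bool \<Rightarrow> index \<Rightarrow> 'a) \<Rightarrow> 'a)"
        using exchange_cong_exponent[OF cong(2)[of m]] m(1) by (auto simp: fun_eq_iff)
      show ?thesis
        by (rule equiv_mod_trans[OF chain[of s, unfolded eq] equiv_mod_sym[OF chain[of s']]])
           simp_all
    qed
    ultimately show ?thesis by (intro exI[of _ a] exI[of _ s']) simp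
  qed
  then obtain a' t where dec': "decomposition \<beta> a' n t"
    and equiv: "equiv_mod n \<Omega> (?h a s) (?h a' t)"
    by blast
  then obtain F G where "polynomial_in (Delta n \<Omega>) F" "polynomial_in (Delta n \<Omega>) G"
    and FG: "\<And>l r. adjacent \<Omega> l r \<Longrightarrow>
      ?h a s (side l r) - ?h a' t (side l r) = F l + G r"
    unfolding equiv_mod_def separable_def by blast
  then obtain f g where "mpoly_vars f \<subseteq> Delta n \<Omega>" "mpoly_vars g \<subseteq> Delta n \<Omega>"
    and fg: "\<And>x. mpoly_eval f x = F x" "\<And>x. mpoly_eval g x = G x"
    unfolding polynomial_in_def by blast
  moreover have "zeta_L \<alpha> l + zeta_R \<alpha> r - zeta_L \<beta> l - zeta_R \<beta> r =
      mpoly_eval f l + mpoly_eval g r" if "(LV l, RV r) \<in> edges \<Omega>" for l r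
  proof -
    have adj: "adjacent \<Omega> l r" using that by (auto simp: edges_def)
    show ?thesis
      using FG[OF adj] zeta_sum_eq_exchange[OF assms(2) adj assms(14) dec]
        zeta_sum_eq_exchange[OF assms(2) adj assms(15) dec']
      by (simp only: fg diff_diff_eq)
  qed
  ultimately show ?thesis by blast
qed

end
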